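(* Assume (P1) and (P2) with constant $\rho$ (defined in the context). Let $\mathcal{A}_1$ be an algorithm that, given a budget $B$, outputs a set $S\subseteq[n]$ with $\sum_{i\in S} c_i \le B$ and $\min_{o\in\mathcal{O}_{\bar S}} \mathbb{E}[h_{\bar S}(o;\mathbf{v}_{\bar S})] \le \gamma_1 \mathcal{G}^*(B)$, and let $\mathcal{A}_2$ be an algorithm that, given $S$ and $\mathbf{v}_S$, outputs $\nu_{\mathbf{v}_S}\in\mathcal{O}$ with $\mathbb{E}_{\mathbf{v}_{\bar S}}[h(\nu_{\mathbf{v}_S};\mathbf{v}_S,\mathbf{v}_{\bar S})] \le \gamma_2 \min_{o\in\mathcal{O}}\mathbb{E}_{\mathbf{v}_{\bar S}}[h(o;\mathbf{v}_S,\mathbf{v}_{\bar S})]$. Consider the non-adaptive algorithm: compute $S$ by $\mathcal{A}_1$, probe all of $S$, and output $\nu_{\mathbf{v}_S}$ computed by $\mathcal{A}_2$. With $B = C$, its value $\mathbb{E}_{\mathbf{v}_S}\mathbb{E}_{\mathbf{v}_{\bar S}}[h(\nu_{\mathbf{v}_S};\mathbf{v}_S,\mathbf{v}_{\bar S})]$ is at most $\gamma_2\rho(\gamma_1+2)\, OPT_h$. For any $\beta>0$, with $B=(1+\beta)C$ (outlier cost $(1+\beta)C$), its value is at most $\gamma_2\rho(\gamma_1+2)\left(1+\frac1\beta\right) OPT_s$.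
   Context: General probing framework. $X_1,\dots,X_n$ are independent random variables with given distributions. For $S\subseteq[n]$, $\mathbf{v}_S$ is a realization of $\{X_i:i\in S\}$, $\bar S=[n]\setminus S$. For every $A\subseteq[n]$ there is a set $\mathcal{O}_A$ of feasible solutions on the variables in $A$ and a nonnegative objective $h_A(o;\mathbf{v}_A)$ to be minimized; $\mathcal{O}=\mathcal{O}_{[n]}$, $h=h_{[n]}$. Variable $i$ has probing cost $c_i\ge0$; $C\ge\max_i c_i$ is the budget. An adaptive policy is a decision tree of probes; at a leaf with probed set $S$ and outcome $\mathbf{v}_S$ its value is $\min_{o\in\mathcal{O}}\mathbb{E}_{\mathbf{v}_{\bar S}}[h(o;\mathbf{v}_S,\mathbf{v}_{\bar S})]$, and the policy's value is the expectation over leaves. $OPT_h$: minimum value over adaptive policies with probing cost at most $C$ on every path; $OPT_s$: minimum value over adaptive policies with expected probing cost at most $C$. Outlier problem: $\mathcal{G}^*(B)=\min\{\min_{o\in\mathcal{O}_{\bar S}}\mathbb{E}[h_{\bar S}(o;\mathbf{v}_{\bar S})] : \sum_{i\in S}c_i\le B\}$. (P1): for every $o\in\mathcal{O}$ and $A\subseteq[n]$ there is $o_A\in\mathcal{O}_A$ with $h_A(o_A;\mathbf{v}_A)\le h(o;\mathbf{v})$ for all $\mathbf{v}$. (P2) with constant $\rho$: for all $A\subseteq[n]$ and all $\mathbf{v}_A$, $\min_{o\in\mathcal{O}}\mathbb{E}[h(o;\mathbf{v}_A,\mathbf{v}_{\bar A})] \le \rho\big(\min_{o\in\mathcal{O}_A}h_A(o;\mathbf{v}_A)+\min_{o\in\mathcal{O}_{\bar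 A}}\mathbb{E}[h_{\bar A}(o;\mathbf{v}_{\bar A})]+\mathbb{E}[\min_{o\in\mathcal{O}}h(o;\mathbf{v}_A,\mathbf{v}_{\bar A})]\big)$, expectations over $\mathbf{v}_{\bar A}$. *)

theory Defs
  imports "HOL-Probability.Probability"
begin

text \<open>
  An instance of the probing framework. The random variables live on an arbitrary probability
  space and take values in measurable spaces \<open>val_space P i\<close>. A realization of the variables
  in \<open>A\<close> is an element of \<open>space (PiM A (val_space P))\<close>, so the objective for \<open>A\<close> sees the
  values of the variables in \<open>A\<close> only. Objectives are \<open>ennreal\<close>-valued, so that expectations
  (\<open>nn_integral\<close>) exist without integrability assumptions.
\<close>

record ('w, 'a, 's) probing =
  sample :: "'w measure"
  nvars :: nat
  val_space :: "nat \<Rightarrow> 'a measure"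
  rv :: "nat \<Rightarrow> 'w \<Rightarrow> 'a"
  cost :: "nat \<Rightarrow> real"
  feas :: "nat set \<Rightarrow> 's set"
  obj :: "nat set \<Rightarrow> 's \<Rightarrow> (nat \<Rightarrow> 'a) \<Rightarrow> ennreal"

definition vars :: "('w, 'a, 's) probing \<Rightarrow> nat set" where
  "vars P = {1..nvars P}"

definition realizations :: "('w, 'a, 's) probing \<Rightarrow> nat set \<Rightarrow> (nat \<Rightarrow> 'a) set" where
  "realizations P A = space (PiM A (val_space P))"

definition outcome :: "('w, 'a, 's) probing \<Rightarrow> nat set \<Rightarrow> 'w \<Rightarrow> nat \<Rightarrow> 'a" where
  "outcome P A \<omega> = (\<lambda>i\<in>A. rv P i \<omega>)"

text \<open>
  The two measurability clauses say that the random quantities whose expectations occur in the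
  framework are random variables. The last one is automatic if there are countably many feasible
  solutions or if the value spaces are countable and discrete.
\<close>

definition probing_instance :: "('w, 'a, 's) probing \<Rightarrow> bool" where
  "probing_instance P \<longleftrightarrow>
     prob_space (sample P) \<and>
     prob_space.indep_vars (sample P) (val_space P) (rv P) (vars P) \<and>
     (\<forall>i\<in>vars P. 0 \<le> cost P i) \<and>
     (\<forall>A\<subseteq>vars P. \<forall>s\<in>feas P A. obj P A s \<in> borel_measurable (PiM A (val_space P))) \<and>
     (\<lambda>v. INF s\<in>feas P (vars P). obj P (vars P) s v)
       \<in> borel_measurable (PiM (vars P) (val_space P))"

text \<open>The full vector that agrees with \<open>v\<close> on \<open>S\<close> and is given by the sample point elsewhere.\<close>

definition completion ::
  "('w, 'a, 's) probing \<Rightarrow> nat set \<Rightarrow> (nat \<Rightarrow> 'a) \<Rightarrow> 'w \<Rightarrow> nat \<Rightarrow> 'a" where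
  "completion P S v \<omega> = merge S (vars P - S) (v, outcome P (vars P - S) \<omega>)"

text \<open>Expected objective of \<open>s\<close> once the values \<open>v\<close> of the variables in \<open>S\<close> are known.\<close>

definition cond_obj ::
  "('w, 'a, 's) probing \<Rightarrow> nat set \<Rightarrow> (nat \<Rightarrow> 'a) \<Rightarrow> 's \<Rightarrow> ennreal" where
  "cond_obj P S v s = (\<integral>\<^sup>+\<omega>. obj P (vars P) s (completion P S v \<omega>) \<partial>sample P)"

text \<open>Minima over solutions, sets and policies are rendered as infima in \<open>ennreal\<close>.\<close>

definition leaf_value :: "('w, 'a, 's) probing \<Rightarrow> nat set \<Rightarrow> (nat \<Rightarrow> 'a) \<Rightarrow> ennreal" where
  "leaf_value P S v = (INF s\<in>feas P (vars P). cond_obj P S v s)"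

definition unprobed_value :: "('w, 'a, 's) probing \<Rightarrow> nat set \<Rightarrow> ennreal" where
  "unprobed_value P A = (INF s\<in>feas P A. \<integral>\<^sup>+\<omega>. obj P A s (outcome P A \<omega>) \<partial>sample P)"

definition set_cost :: "('w, 'a, 's) probing \<Rightarrow> nat set \<Rightarrow> real" where
  "set_cost P S = (\<Sum>i\<in>S. cost P i)"

definition outlier_opt :: "('w, 'a, 's) probing \<Rightarrow> real \<Rightarrow> ennreal" where
  "outlier_opt P B = (INF S\<in>{S. S \<subseteq> vars P \<and> set_cost P S \<le> B}. unprobed_value P (vars P - S))"

text \<open>Decision trees: an inner node names the variable to probe and branches on its value.\<close>

datatype 'a policy = Stop | Probe nat "'a \<Rightarrow> 'a policy"

primrec probe_seq :: "'a policy \<Rightarrow> (nat \<Rightarrow> 'a) \<Rightarrow> nat list" where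
  "probe_seq Stop v = []"
| "probe_seq (Probe i k) v = i # probe_seq (k (v i)) v"

definition probed :: "'a policy \<Rightarrow> (nat \<Rightarrow> 'a) \<Rightarrow> nat set" where
  "probed T v = set (probe_seq T v)"

text \<open>
  Measurability of the probing sequence says that every decision is a measurable function of the
  values seen so far; for countable discrete value spaces it holds for every tree.
\<close>

definition policies :: "('w, 'a, 's) probing \<Rightarrow> 'a policy set" where
  "policies P = {T.
     (\<forall>v\<in>realizations P (vars P). distinct (probe_seq T v) \<and> probed T v \<subseteq> vars P) \<and>
     probe_seq T \<in> measurable (PiM (vars P) (val_space P)) (count_space UNIV)}"

definition policy_value :: "('w, 'a, 's) probing \<Rightarrow> 'a policy \<Rightarrow> ennreal" where
  "policy_value P T =
     (\<integral>\<^sup>+\<omega>. (let S = probed T (outcome P (vars P) \<omega>) in leaf_value P S (outcome P S \<omega>)) \<partial>sample P)"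

definition expected_cost :: "('w, 'a, 's) probing \<Rightarrow> 'a policy \<Rightarrow> real" where
  "expected_cost P T = (\<integral>\<omega>. set_cost P (probed T (outcome P (vars P) \<omega>)) \<partial>sample P)"

definition OPT_h :: "('w, 'a, 's) probing \<Rightarrow> real \<Rightarrow> ennreal" where
  "OPT_h P C =
     (INF T\<in>{T\<in>policies P. \<forall>v\<in>realizations P (vars P). set_cost P (probed T v) \<le> C}.
        policy_value P T)"

definition OPT_s :: "('w, 'a, 's) probing \<Rightarrow> real \<Rightarrow> ennreal" where
  "OPT_s P C = (INF T\<in>{T\<in>policies P. expected_cost P T \<le> C}. policy_value P T)"

definition P1 :: "('w, 'a, 's) probing \<Rightarrow> bool" where
  "P1 P \<longleftrightarrow>
     (\<forall>s\<in>feas P (vars P). \<forall>A\<subseteq>vars P. \<exists>t\<in>feas P A.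
        \<forall>v\<in>realizations P (vars P). obj P A t (restrict v A) \<le> obj P (vars P) s v)"

definition P2 :: "('w, 'a, 's) probing \<Rightarrow> real \<Rightarrow> bool" where
  "P2 P \<rho> \<longleftrightarrow>
     (\<forall>A\<subseteq>vars P. \<forall>v\<in>realizations P A.
        (INF s\<in>feas P (vars P). cond_obj P A v s) \<le>
        ennreal \<rho> *
          ((INF s\<in>feas P A. obj P A s v) +
           unprobed_value P (vars P - A) +
           (\<integral>\<^sup>+\<omega>. (INF s\<in>feas P (vars P). obj P (vars P) s (completion P A v \<omega>)) \<partial>sample P)))"

definition outlier_algorithm ::
  "('w, 'a, 's) probing \<Rightarrow> real \<Rightarrow> (real \<Rightarrow> nat set) \<Rightarrow> bool" where
  "outlier_algorithm P \<gamma> alg \<longleftrightarrow>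
     (\<forall>B\<ge>0. alg B \<subseteq> vars P \<and> set_cost P (alg B) \<le> B \<and>
        unprobed_value P (vars P - alg B) \<le> ennreal \<gamma> * outlier_opt P B)"

definition solution_algorithm ::
  "('w, 'a, 's) probing \<Rightarrow> real \<Rightarrow> (nat set \<Rightarrow> (nat \<Rightarrow> 'a) \<Rightarrow> 's) \<Rightarrow> bool" where
  "solution_algorithm P \<gamma> alg \<longleftrightarrow>
     (\<forall>S\<subseteq>vars P. \<forall>v\<in>realizations P S. alg S v \<in> feas P (vars P) \<and>
        cond_obj P S v (alg S v) \<le> ennreal \<gamma> * (INF s\<in>feas P (vars P). cond_obj P S v s))"

text \<open>Probe all of \<open>S\<close>, then output the solution that \<open>alg\<close> selects from the observed values.\<close>

definition nonadaptive_value ::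
  "('w, 'a, 's) probing \<Rightarrow> nat set \<Rightarrow> (nat set \<Rightarrow> (nat \<Rightarrow> 'a) \<Rightarrow> 's) \<Rightarrow> ennreal" where
  "nonadaptive_value P S alg =
     (\<integral>\<^sup>+\<omega>. cond_obj P S (outcome P S \<omega>) (alg S (outcome P S \<omega>)) \<partial>sample P)"

end

theory Submission
  imports Defs
begin

text \<open>
  Let \<open>M\<close> be the expected value of the clairvoyant optimum. Every leaf of a policy is worth at least
  the conditional expectation of the clairvoyant optimum given the path (so every policy is worth
  at least \<open>M\<close>), and by (P1) also at least the outlier value of the set of unprobed variables.
  Hence \<open>M\<close> and \<open>outlier_opt P C\<close> are below \<open>OPT_h\<close>; under an expected budget, Markov's inequality
  says that a fraction \<open>\<beta> / (1 + \<beta>)\<close> of the leaves has cost at most \<open>(1 + \<beta>) C\<close>. Conversely, taking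
  expectations in (P2) bounds the non-adaptive algorithm by \<open>\<gamma>\<^sub>2 \<rho> (\<gamma>\<^sub>1 outlier_opt + 2 M)\<close>: the first
  term of (P2) is below the clairvoyant optimum by (P1), and the third one averages to \<open>M\<close>.
\<close>

section \<open>The clairvoyant optimum and elementary identities for outcomes\<close>

definition clairvoyant :: "('w, 'a, 's) probing \<Rightarrow> (nat \<Rightarrow> 'a) \<Rightarrow> ennreal" where
  "clairvoyant P v = (INF s\<in>feas P (vars P). obj P (vars P) s v)"

definition clairvoyant_value :: "('w, 'a, 's) probing \<Rightarrow> ennreal" where
  "clairvoyant_value P = (\<integral>\<^sup>+\<omega>. clairvoyant P (outcome P (vars P) \<omega>) \<partial>sample P)"

text \<open>A decision tree reads only the variables that it probes, so changing the others leaves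
  the path unchanged. This is why the event of probing exactly \<open>S\<close> depends on the
  coordinates in \<open>S\<close> alone.\<close>

lemma probe_seq_cong:
  assumes "\<And>i. i \<in> probed T v \<Longrightarrow> w i = v i"
  shows "probe_seq T w = probe_seq T v"
  using assms by (induction T) (auto simp: probed_def)

lemma finite_vars [simp]: "finite (vars P)"
  by (simp add: vars_def)

lemma set_cost_nonneg:
  assumes "\<forall>i\<in>vars P. 0 \<le> cost P i" "S \<subseteq> vars P"
  shows "0 \<le> set_cost P S"
  unfolding set_cost_def using assms by (intro sum_nonneg) auto

lemma restrict_outcome:
  "A \<subseteq> vars P \<Longrightarrow> restrict (outcome P (vars P) \<omega>) A = outcome P A \<omega>"
  by (auto simp: outcome_def restrict_def fun_eq_iff)

lemma completion_outcome:
  "S \<subseteq> vars P \<Longrightarrow> completion P S (outcome P S \<omega>) \<omega> = outcome P (vars P) \<omega>"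
  by (auto simp: completion_def outcome_def merge_def restrict_def fun_eq_iff)

lemma restrict_completion:
  "restrict (completion P S v \<omega>) (vars P - S) = outcome P (vars P - S) \<omega>"
  by (auto simp: completion_def outcome_def merge_def restrict_def fun_eq_iff)

context
  fixes P :: "('w, 'a, 's) probing"
  assumes inst: "probing_instance P"
begin

interpretation prob_space "sample P"
  using inst by (simp add: probing_instance_def)

lemma indep_rv: "indep_vars (val_space P) (rv P) (vars P)"
  using inst by (simp add: probing_instance_def)

lemma cost_nonneg: "\<forall>i\<in>vars P. 0 \<le> cost P i"
  using inst by (simp add: probing_instance_def)

section \<open>Measurability and resampling of the unprobed variables\<close>

lemma measurable_outcome:
  "A \<subseteq> vars P \<Longrightarrow> outcome P A \<in> measurable (sample P) (PiM A (val_space P))"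
  using indep_rv unfolding outcome_def indep_vars_def
  by (intro measurable_restrict) auto

lemma outcome_in_realizations:
  "A \<subseteq> vars P \<Longrightarrow> \<omega> \<in> space (sample P) \<Longrightarrow> outcome P A \<omega> \<in> realizations P A"
  unfolding realizations_def using measurable_outcome by (rule measurable_space)

lemma completion_in_realizations:
  assumes "S \<subseteq> vars P" "v \<in> realizations P S" "\<omega> \<in> space (sample P)"
  shows "completion P S v \<omega> \<in> realizations P (vars P)"
  using assms outcome_in_realizations[of "vars P - S" \<omega>]
  by (auto simp: realizations_def completion_def space_PiM merge_def PiE_def Pi_def extensional_def)

lemma measurable_clairvoyant:
  "clairvoyant P \<in> borel_measurable (PiM (vars P) (val_space P))"
  using inst unfolding probing_instance_def clairvoyant_def by blast

lemma measurable_resample: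
  assumes S: "S \<subseteq> vars P" and f: "f \<in> borel_measurable (PiM (vars P) (val_space P))"
  shows "(\<lambda>v. \<integral>\<^sup>+\<omega>. f (completion P S v \<omega>) \<partial>sample P) \<in> borel_measurable (PiM S (val_space P))"
proof -
  have [measurable]: "outcome P (vars P - S) \<in> measurable (sample P) (PiM (vars P - S) (val_space P))"
    by (rule measurable_outcome) auto
  have "S \<union> (vars P - S) = vars P"
    using S by auto
  then have [measurable]: "merge S (vars P - S) \<in>
      measurable (PiM S (val_space P) \<Otimes>\<^sub>M PiM (vars P - S) (val_space P)) (PiM (vars P) (val_space P))"
    using measurable_merge[of S "vars P - S" "val_space P"] by simp
  note f[measurable]
  show ?thesis
    unfolding completion_def by measurable
qed

text \<open>For a fixed set \<open>S\<close>, independence makes the joint law of the outcomes on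
  \<open>S\<close> and on its complement a product measure. By Fubini, an independent fresh copy of
  the values outside \<open>S\<close> leaves the expectation unchanged.\<close>

lemma nn_integral_resample:
  assumes S: "S \<subseteq> vars P" and f: "f \<in> borel_measurable (PiM (vars P) (val_space P))"
  shows "(\<integral>\<^sup>+\<omega>. \<integral>\<^sup>+\<omega>'. f (completion P S (outcome P S \<omega>) \<omega>') \<partial>sample P \<partial>sample P)
    = (\<integral>\<^sup>+\<omega>. f (outcome P (vars P) \<omega>) \<partial>sample P)"
proof -
  let ?R = "vars P - S"
  let ?S = "PiM S (val_space P)" and ?T = "PiM ?R (val_space P)"
  let ?X = "outcome P S" and ?Y = "outcome P ?R"
  let ?g = "\<lambda>p. f (merge S ?R p)"
  have X: "?X \<in> measurable (sample P) ?S" and Y: "?Y \<in> measurable (sample P) ?T"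
    using S by (auto intro: measurable_outcome)
  have "S \<union> ?R = vars P"
    using S by auto
  then have "merge S ?R \<in> measurable (?S \<Otimes>\<^sub>M ?T) (PiM (vars P) (val_space P))"
    using measurable_merge[of S ?R "val_space P"] by simp
  then have g: "?g \<in> borel_measurable (?S \<Otimes>\<^sub>M ?T)"
    using f by (rule measurable_compose)
  have "indep_var ?S ?X ?T ?Y"
    unfolding outcome_def using S by (intro indep_var_restrict[OF indep_rv]) auto
  then have joint: "distr (sample P) ?S ?X \<Otimes>\<^sub>M distr (sample P) ?T ?Y
      = distr (sample P) (?S \<Otimes>\<^sub>M ?T) (\<lambda>\<omega>. (?X \<omega>, ?Y \<omega>))"
    by (simp add: indep_var_distribution_eq)
  interpret Y: prob_space "distr (sample P) ?T ?Y"
    by (rule prob_space_distr) fact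
  have "(\<integral>\<^sup>+\<omega>. \<integral>\<^sup>+\<omega>'. f (completion P S (?X \<omega>) \<omega>') \<partial>sample P \<partial>sample P)
      = (\<integral>\<^sup>+v. \<integral>\<^sup>+\<omega>'. ?g (v, ?Y \<omega>') \<partial>sample P \<partial>distr (sample P) ?S ?X)"
    using measurable_resample[OF S f] unfolding completion_def
    by (subst nn_integral_distr[OF X]) auto
  also have "\<dots> = (\<integral>\<^sup>+v. \<integral>\<^sup>+w. ?g (v, w) \<partial>distr (sample P) ?T ?Y \<partial>distr (sample P) ?S ?X)"
    using g by (intro nn_integral_cong nn_integral_distr[OF Y, symmetric])
      (auto intro: measurable_compose[OF measurable_Pair1'])
  also have "\<dots> = integral\<^sup>N (distr (sample P) ?S ?X \<Otimes>\<^sub>M distr (sample P) ?T ?Y) ?g"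
    by (rule Y.nn_integral_fst) (use g in simp)
  also have "\<dots> = (\<integral>\<^sup>+\<omega>. ?g (?X \<omega>, ?Y \<omega>) \<partial>sample P)"
    unfolding joint using g X Y by (intro nn_integral_distr) auto
  also have "\<dots> = (\<integral>\<^sup>+\<omega>. f (outcome P (vars P) \<omega>) \<partial>sample P)"
    using completion_outcome[OF S] by (simp add: completion_def)
  finally show ?thesis .
qed

section \<open>Two lower bounds on the value of a single leaf\<close>

lemma clairvoyant_le_leaf_value:
  "(\<integral>\<^sup>+\<omega>. clairvoyant P (completion P S v \<omega>) \<partial>sample P) \<le> leaf_value P S v"
  unfolding leaf_value_def cond_obj_def clairvoyant_def
  \<comment> \<open>The expectation of a minimum is at most the minimum of the expectations.\<close>
  by (intro INF_greatest nn_integral_mono INF_lower)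

text \<open>(P1), applied to the unprobed variables, turns a solution at the leaf into one whose
  objective ignores \<open>v\<close>. Its expectation is therefore the same whatever was observed on
  \<open>S\<close>.\<close>

lemma unprobed_value_le_leaf_value:
  assumes "P1 P" "S \<subseteq> vars P" "v \<in> realizations P S"
  shows "unprobed_value P (vars P - S) \<le> leaf_value P S v"
  unfolding leaf_value_def
proof (rule INF_greatest)
  fix s assume "s \<in> feas P (vars P)"
  then obtain t where t: "t \<in> feas P (vars P - S)"
    and le: "\<And>w. w \<in> realizations P (vars P) \<Longrightarrow>
      obj P (vars P - S) t (restrict w (vars P - S)) \<le> obj P (vars P) s w"
    using \<open>P1 P\<close> unfolding P1_def by (meson Diff_subset)
  have "unprobed_value P (vars P - S)
      \<le> (\<integral>\<^sup>+\<omega>. obj P (vars P - S) t (outcome P (vars P - S) \<omega>) \<partial>sample P)"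
    unfolding unprobed_value_def using t by (rule INF_lower)
  also have "\<dots> \<le> cond_obj P S v s"
    unfolding cond_obj_def
    using le[OF completion_in_realizations[OF assms(2,3)]]
    by (intro nn_integral_mono) (simp add: restrict_completion)
  finally show "unprobed_value P (vars P - S) \<le> cond_obj P S v s" .
qed

lemma INF_obj_restrict_le_clairvoyant:
  assumes "P1 P" "A \<subseteq> vars P" "v \<in> realizations P (vars P)"
  shows "(INF s\<in>feas P A. obj P A s (restrict v A)) \<le> clairvoyant P v"
  unfolding clairvoyant_def
proof (rule INF_greatest)
  fix s assume "s \<in> feas P (vars P)"
  then obtain t where "t \<in> feas P A" "obj P A t (restrict v A) \<le> obj P (vars P) s v"
    using assms unfolding P1_def by meson
  then show "(INF s\<in>feas P A. obj P A s (restrict v A)) \<le> obj P (vars P) s v"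
    by (rule INF_lower2)
qed

section \<open>Policies against the clairvoyant optimum\<close>

lemma measurable_probed:
  assumes "T \<in> policies P"
  shows "probed T \<in> measurable (PiM (vars P) (val_space P)) (count_space UNIV)"
  using assms unfolding policies_def probed_def
  by (auto intro: measurable_compose[where g = set])

lemma probed_subset:
  "T \<in> policies P \<Longrightarrow> v \<in> realizations P (vars P) \<Longrightarrow> probed T v \<subseteq> vars P"
  by (auto simp: policies_def)

text \<open>The probed set is random, whereas resampling needs a fixed set. So the expectation is
  split over the finitely many possible probed sets, resampled in each piece, and reassembled: at a
  given sample point only the piece of the actually probed set survives.\<close>

lemma clairvoyant_value_le_policy_value:
  assumes T: "T \<in> policies P"
  shows "clairvoyant_value P \<le> policy_value P T"
proof -
  let ?N = "PiM (vars P) (val_space P)"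
  let ?f = "\<lambda>S v. clairvoyant P v * indicator {v. probed T v = S} v"
  note [measurable] = measurable_probed[OF T] measurable_clairvoyant measurable_outcome[OF order_refl]
  \<comment> \<open>The set under the indicator need not lie inside \<open>space ?N\<close>; only
    its trace on that space is shown to be measurable.\<close>
  have f: "?f S \<in> borel_measurable ?N" for S
  proof -
    have "{v \<in> space ?N. probed T v = S} \<in> sets ?N"
      by measurable
    then have "(\<lambda>v. indicator {v. probed T v = S} v :: ennreal) \<in> borel_measurable ?N"
      by (subst borel_measurable_indicator_iff) (simp add: Int_def conj_commute)
    then show ?thesis
      by measurable
  qed
  have "clairvoyant_value P
      = (\<integral>\<^sup>+\<omega>. (\<Sum>S\<in>Pow (vars P). ?f S (outcome P (vars P) \<omega>)) \<partial>sample P)"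
    unfolding clairvoyant_value_def
  proof (rule nn_integral_cong)
    fix \<omega> assume "\<omega> \<in> space (sample P)"
    then have "probed T (outcome P (vars P) \<omega>) \<in> Pow (vars P)"
      using probed_subset[OF T] outcome_in_realizations by blast
    then show "clairvoyant P (outcome P (vars P) \<omega>)
        = (\<Sum>S\<in>Pow (vars P). ?f S (outcome P (vars P) \<omega>))"
      by (subst sum.remove) (auto intro!: sum.neutral)
  qed
  also have "\<dots> = (\<Sum>S\<in>Pow (vars P). \<integral>\<^sup>+\<omega>. ?f S (outcome P (vars P) \<omega>) \<partial>sample P)"
    by (rule nn_integral_sum) (rule measurable_compose[OF measurable_outcome[OF order_refl] f])
  also have "\<dots> = (\<Sum>S\<in>Pow (vars P).
      \<integral>\<^sup>+\<omega>. \<integral>\<^sup>+\<omega>'. ?f S (completion P S (outcome P S \<omega>) \<omega>') \<partial>sample P \<partial>sample P)"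
    by (intro sum.cong refl nn_integral_resample[OF _ f, symmetric]) auto
  also have "\<dots> = (\<integral>\<^sup>+\<omega>. (\<Sum>S\<in>Pow (vars P).
      \<integral>\<^sup>+\<omega>'. ?f S (completion P S (outcome P S \<omega>) \<omega>') \<partial>sample P) \<partial>sample P)"
    by (intro nn_integral_sum[symmetric] measurable_compose[OF measurable_outcome measurable_resample[OF _ f]]) auto
  also have "\<dots> \<le> policy_value P T"
    unfolding policy_value_def Let_def
  proof (rule nn_integral_mono)
    fix \<omega> assume \<omega>: "\<omega> \<in> space (sample P)"
    let ?S = "probed T (outcome P (vars P) \<omega>)"
    let ?c = "\<lambda>S \<omega>'. completion P S (outcome P S \<omega>) \<omega>'"
    have S: "?S \<in> Pow (vars P)"
      using probed_subset[OF T] outcome_in_realizations[OF order_refl \<omega>] by blast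
    text \<open>Whether the policy probes exactly \<open>S\<close> is determined by the values of the variables in \<open>S\<close>.\<close>
    have det: "S = ?S" if "S \<subseteq> vars P" "probed T (?c S \<omega>') = S" for S \<omega>'
    proof -
      have "probe_seq T (outcome P (vars P) \<omega>) = probe_seq T (?c S \<omega>')"
        by (rule probe_seq_cong)
          (use that in \<open>auto simp: completion_def outcome_def merge_def\<close>)
      then show ?thesis
        using that by (simp add: probed_def)
    qed
    have "(\<Sum>S\<in>Pow (vars P). \<integral>\<^sup>+\<omega>'. ?f S (?c S \<omega>') \<partial>sample P)
        = (\<integral>\<^sup>+\<omega>'. ?f ?S (?c ?S \<omega>') \<partial>sample P)"
    proof -
      \<comment> \<open>A completion on which the policy probes exactly \<open>S\<close> would, by
        \<open>det\<close>, force \<open>S\<close> to be the set probed at \<omega>; for every other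
        \<open>S\<close> the integrand vanishes identically.\<close>
      have "(\<integral>\<^sup>+\<omega>'. ?f S (?c S \<omega>') \<partial>sample P) = 0" if "S \<in> Pow (vars P) - {?S}" for S
      proof -
        have "?f S (?c S \<omega>') = 0" for \<omega>'
          using det[of S \<omega>'] that by (auto simp: indicator_def)
        then show ?thesis
          by (simp only: nn_integral_const mult_zero_left)
      qed
      then show ?thesis
        using S by (subst sum.remove[where x = ?S]) (auto intro!: sum.neutral)
    qed
    also have "\<dots> \<le> (\<integral>\<^sup>+\<omega>'. clairvoyant P (?c ?S \<omega>') \<partial>sample P)"
      by (intro nn_integral_mono) (auto simp: indicator_def)
    also have "\<dots> \<le> leaf_value P ?S (outcome P ?S \<omega>)"
      by (rule clairvoyant_le_leaf_value)
    finally show "(\<Sum>S\<in>Pow (vars P). \<integral>\<^sup>+\<omega>'. ?f S (?c S \<omega>') \<partial>sample P)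
        \<le> leaf_value P ?S (outcome P ?S \<omega>)" .
  qed
  finally show ?thesis .
qed

section \<open>Policies against the outlier optimum\<close>

lemma outlier_opt_le_leaf_value:
  assumes P1: "P1 P" and T: "T \<in> policies P" and \<omega>: "\<omega> \<in> space (sample P)"
    and B: "set_cost P (probed T (outcome P (vars P) \<omega>)) \<le> B"
  shows "outlier_opt P B \<le>
    (let S = probed T (outcome P (vars P) \<omega>) in leaf_value P S (outcome P S \<omega>))"
proof -
  let ?S = "probed T (outcome P (vars P) \<omega>)"
  have S: "?S \<subseteq> vars P"
    using probed_subset[OF T] outcome_in_realizations[OF order_refl \<omega>] by blast
  \<comment> \<open>The set probed on the path is itself a candidate for the outlier set with budget
    \<open>B\<close>.\<close>
  have "outlier_opt P B \<le> unprobed_value P (vars P - ?S)"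
    unfolding outlier_opt_def using S B by (intro INF_lower) auto
  also have "\<dots> \<le> leaf_value P ?S (outcome P ?S \<omega>)"
    using P1 S outcome_in_realizations[OF S \<omega>] by (rule unprobed_value_le_leaf_value)
  finally show ?thesis
    by (simp add: Let_def)
qed

lemma outlier_opt_le_OPT_h:
  assumes "P1 P"
  shows "outlier_opt P C \<le> OPT_h P C"
  unfolding OPT_h_def
proof (rule INF_greatest)
  fix T assume T: "T \<in> {T\<in>policies P. \<forall>v\<in>realizations P (vars P). set_cost P (probed T v) \<le> C}"
  have "outlier_opt P C = (\<integral>\<^sup>+\<omega>. outlier_opt P C \<partial>sample P)"
    by (simp add: emeasure_space_1)
  also have "\<dots> \<le> policy_value P T"
    unfolding policy_value_def
    using T outcome_in_realizations
    by (intro nn_integral_mono outlier_opt_le_leaf_value[OF assms]) auto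
  finally show "outlier_opt P C \<le> policy_value P T" .
qed

text \<open>Markov's inequality at the threshold (1 + \<beta>) C bounds the probability of exceeding
  it by 1 / (1 + \<beta>), and \<open>E\<close> is the complementary event.\<close>

lemma expected_cost_Markov:
  assumes T: "T \<in> policies P" and "0 \<le> C" "\<forall>i\<in>vars P. cost P i \<le> C"
    and exp: "expected_cost P T \<le> C" and "0 < \<beta>"
  defines "E \<equiv> {\<omega>\<in>space (sample P). set_cost P (probed T (outcome P (vars P) \<omega>)) \<le> (1 + \<beta>) * C}"
  shows "E \<in> events" and "\<beta> / (1 + \<beta>) \<le> prob E"
proof -
  let ?c = "\<lambda>\<omega>. set_cost P (probed T (outcome P (vars P) \<omega>))"
  note [measurable] = measurable_probed[OF T] measurable_outcome[OF order_refl]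
  have sub: "probed T (outcome P (vars P) \<omega>) \<subseteq> vars P" if "\<omega> \<in> space (sample P)" for \<omega>
    using probed_subset[OF T] outcome_in_realizations[OF order_refl that] by blast
  have meas [measurable]: "?c \<in> borel_measurable (sample P)"
    by (rule measurable_compose[OF _ borel_measurable_count_space]) measurable
  show E: "E \<in> events"
    unfolding E_def by measurable
  have nonneg: "0 \<le> ?c \<omega>" if "\<omega> \<in> space (sample P)" for \<omega>
    using cost_nonneg sub[OF that] by (rule set_cost_nonneg)
  have int: "integrable (sample P) ?c"
  \<comment> \<open>Costs are nonnegative, so the total cost of all variables dominates the cost of
    every path.\<close>
  proof (rule integrable_const_bound)
    show "AE \<omega> in sample P. norm (?c \<omega>) \<le> set_cost P (vars P)"
      using nonneg sub cost_nonneg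
      by (intro AE_I2) (auto simp: set_cost_def intro!: sum_mono2)
  qed (rule meas)
  show "\<beta> / (1 + \<beta>) \<le> prob E"
  proof (cases "C = 0")
    \<comment> \<open>The threshold is then 0, where Markov's inequality says nothing; but every
      single cost is at most \<open>C\<close>, so no path costs anything.\<close>
    case True
    have "?c \<omega> \<le> (1 + \<beta>) * C" if "\<omega> \<in> space (sample P)" for \<omega>
      using assms(3) sub[OF that] True by (auto simp: set_cost_def intro!: sum_nonpos)
    then have "E = space (sample P)"
      by (auto simp: E_def)
    then show ?thesis
      using \<open>0 < \<beta>\<close> by (simp add: prob_space)
  next
    case False
    then have pos: "0 < (1 + \<beta>) * C"
      using assms by simp
    let ?F = "{\<omega>\<in>space (sample P). ?c \<omega> \<ge> (1 + \<beta>) * C}"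
    have "space (sample P) - E \<subseteq> ?F"
      by (auto simp: E_def)
    then have "1 - prob E \<le> prob ?F"
      using E by (subst prob_compl[symmetric]) (auto intro!: finite_measure_mono)
    also have "\<dots> \<le> expected_cost P T / ((1 + \<beta>) * C)"
      unfolding expected_cost_def
      by (rule integral_Markov_inequality_measure[where A = "{}"])
        (use int nonneg pos in auto)
    also have "\<dots> \<le> C / ((1 + \<beta>) * C)"
      using exp pos by (intro divide_right_mono) auto
    also have "\<dots> = 1 / (1 + \<beta>)"
      using False by simp
    also have "\<dots> = 1 - \<beta> / (1 + \<beta>)"
      using \<open>0 < \<beta>\<close> by (simp add: field_simps)
    finally show ?thesis
      by simp
  qed
qed

text \<open>On the Markov event each leaf is worth at least the outlier optimum for the enlarged
  budget; elsewhere the leaf value is bounded below by 0. This loses the factor \<beta> / (1 +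
  \<beta>), whose reciprocal is 1 + 1 / \<beta>.\<close>

lemma outlier_opt_le_OPT_s:
  assumes P1: "P1 P" and "0 \<le> C" "\<forall>i\<in>vars P. cost P i \<le> C" and "0 < \<beta>"
  shows "outlier_opt P ((1 + \<beta>) * C) \<le> ennreal (1 + 1 / \<beta>) * OPT_s P C"
proof -
  let ?B = "(1 + \<beta>) * C"
  have "ennreal (\<beta> / (1 + \<beta>)) * outlier_opt P ?B \<le> OPT_s P C"
    unfolding OPT_s_def
  proof (rule INF_greatest)
    fix T assume "T \<in> {T\<in>policies P. expected_cost P T \<le> C}"
    then have T: "T \<in> policies P" and exp: "expected_cost P T \<le> C"
      by auto
    let ?E = "{\<omega>\<in>space (sample P). set_cost P (probed T (outcome P (vars P) \<omega>)) \<le> ?B}"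
    note E = expected_cost_Markov[OF T assms(2,3) exp \<open>0 < \<beta>\<close>]
    have "ennreal (\<beta> / (1 + \<beta>)) * outlier_opt P ?B \<le> emeasure (sample P) ?E * outlier_opt P ?B"
      using E(2) by (auto simp: emeasure_eq_measure intro!: mult_right_mono ennreal_leI)
    also have "\<dots> = (\<integral>\<^sup>+\<omega>. outlier_opt P ?B * indicator ?E \<omega> \<partial>sample P)"
      using E(1) by (simp add: nn_integral_cmult_indicator mult.commute)
    also have "\<dots> \<le> policy_value P T"
      unfolding policy_value_def
      using outlier_opt_le_leaf_value[OF P1 T]
      by (intro nn_integral_mono) (auto simp: indicator_def)
    finally show "ennreal (\<beta> / (1 + \<beta>)) * outlier_opt P ?B \<le> policy_value P T" .
  qed
  then have "ennreal (1 + 1 / \<beta>) * (ennreal (\<beta> / (1 + \<beta>)) * outlier_opt P ?B)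
      \<le> ennreal (1 + 1 / \<beta>) * OPT_s P C"
    by (rule mult_left_mono) simp
  moreover have "(1 + 1 / \<beta>) * (\<beta> / (1 + \<beta>)) = 1"
    using \<open>0 < \<beta>\<close> by (simp add: divide_simps)
  then have "ennreal (1 + 1 / \<beta>) * ennreal (\<beta> / (1 + \<beta>)) = 1"
    using \<open>0 < \<beta>\<close> by (subst ennreal_mult[symmetric]) auto
  ultimately show ?thesis
    by (simp add: mult.assoc[symmetric])
qed

section \<open>The upper bound on the non-adaptive algorithm, and its combination with the lower
  bounds\<close>

lemma nonadaptive_value_le:
  assumes P1: "P1 P" and P2: "P2 P \<rho>" and alg: "solution_algorithm P \<gamma> alg"
    and S: "S \<subseteq> vars P"
  shows "nonadaptive_value P S alg
    \<le> ennreal \<gamma> * (ennreal \<rho> * (unprobed_value P (vars P - S) + 2 * clairvoyant_value P))"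
proof -
  let ?U = "unprobed_value P (vars P - S)"
  let ?m = "\<lambda>\<omega>. clairvoyant P (outcome P (vars P) \<omega>)"
  let ?g = "\<lambda>\<omega>. \<integral>\<^sup>+\<omega>'. clairvoyant P (completion P S (outcome P S \<omega>) \<omega>') \<partial>sample P"
  have m [measurable]: "?m \<in> borel_measurable (sample P)"
    by (rule measurable_compose[OF measurable_outcome[OF order_refl] measurable_clairvoyant])
  have g [measurable]: "?g \<in> borel_measurable (sample P)"
    by (rule measurable_compose[OF measurable_outcome[OF S]
          measurable_resample[OF S measurable_clairvoyant]])
  have "nonadaptive_value P S alg
      \<le> (\<integral>\<^sup>+\<omega>. ennreal \<gamma> * (ennreal \<rho> * (?m \<omega> + ?U + ?g \<omega>)) \<partial>sample P)"
    unfolding nonadaptive_value_def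
  proof (rule nn_integral_mono)
    fix \<omega> assume \<omega>: "\<omega> \<in> space (sample P)"
    let ?v = "outcome P S \<omega>"
    have v: "?v \<in> realizations P S"
      using S \<omega> by (rule outcome_in_realizations)
    have "cond_obj P S ?v (alg S ?v)
        \<le> ennreal \<gamma> * (INF s\<in>feas P (vars P). cond_obj P S ?v s)"
      using alg S v by (auto simp: solution_algorithm_def)
    also have "\<dots> \<le> ennreal \<gamma> * (ennreal \<rho> * ((INF s\<in>feas P S. obj P S s ?v) + ?U + ?g \<omega>))"
      using P2 S v unfolding P2_def clairvoyant_def by (intro mult_left_mono) auto
    \<comment> \<open>The observed vector is the restriction to \<open>S\<close> of the full outcome
      at the same \<omega>, so (P1) compares the first term with the clairvoyant optimum
      pointwise.\<close>
    also have "\<dots> \<le> ennreal \<gamma> * (ennreal \<rho> * (?m \<omega> + ?U + ?g \<omega>))"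
      using INF_obj_restrict_le_clairvoyant[OF P1 S outcome_in_realizations[OF order_refl \<omega>]]
      unfolding restrict_outcome[OF S] by (intro mult_left_mono add_mono) auto
    finally show "cond_obj P S ?v (alg S ?v)
        \<le> ennreal \<gamma> * (ennreal \<rho> * (?m \<omega> + ?U + ?g \<omega>))" .
  qed
  also have "\<dots> = ennreal \<gamma> * (ennreal \<rho> * ((\<integral>\<^sup>+\<omega>. ?m \<omega> \<partial>sample P) + ?U + (\<integral>\<^sup>+\<omega>. ?g \<omega> \<partial>sample P)))"
    by (simp add: nn_integral_cmult nn_integral_add emeasure_space_1)
  \<comment> \<open>The factor 2 arises because \<open>?m\<close> and, by resampling,
    \<open>?g\<close> both integrate to the clairvoyant value.\<close>
  also have "\<dots> = ennreal \<gamma> * (ennreal \<rho> * (?U + 2 * clairvoyant_value P))"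
    unfolding nn_integral_resample[OF S measurable_clairvoyant]
    by (simp add: clairvoyant_value_def mult_2 ac_simps)
  finally show ?thesis .
qed

text \<open>The common bound \<open>V\<close> serves both budgets: it is \<open>OPT_h P C\<close>
  for the budget \<open>C\<close>, and 1 + 1 / \<beta> times \<open>OPT_s P C\<close> for the budget
  (1 + \<beta>) C.\<close>

lemma nonadaptive_value_le_outlier_opt:
  assumes "P1 P" "P2 P \<rho>" and A1: "outlier_algorithm P \<gamma>\<^sub>1 A\<^sub>1" and "solution_algorithm P \<gamma>\<^sub>2 A\<^sub>2"
    and "0 \<le> \<rho>" "0 \<le> \<gamma>\<^sub>1" "0 \<le> \<gamma>\<^sub>2" "0 \<le> B"
    and "outlier_opt P B \<le> V" "clairvoyant_value P \<le> V"
  shows "nonadaptive_value P (A\<^sub>1 B) A\<^sub>2 \<le> ennreal (\<gamma>\<^sub>2 * \<rho> * (\<gamma>\<^sub>1 + 2)) * V"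
proof -
  have B: "A\<^sub>1 B \<subseteq> vars P" "unprobed_value P (vars P - A\<^sub>1 B) \<le> ennreal \<gamma>\<^sub>1 * outlier_opt P B"
    using A1 \<open>0 \<le> B\<close> by (auto simp: outlier_algorithm_def)
  have "nonadaptive_value P (A\<^sub>1 B) A\<^sub>2
      \<le> ennreal \<gamma>\<^sub>2 * (ennreal \<rho> * (unprobed_value P (vars P - A\<^sub>1 B) + 2 * clairvoyant_value P))"
    using assms B by (intro nonadaptive_value_le) auto
  also have "\<dots> \<le> ennreal \<gamma>\<^sub>2 * (ennreal \<rho> * (ennreal \<gamma>\<^sub>1 * V + 2 * V))"
    using assms by (intro mult_left_mono add_mono order_trans[OF B(2)]) auto
  also have "\<dots> = ennreal (\<gamma>\<^sub>2 * \<rho> * (\<gamma>\<^sub>1 + 2)) * V"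
    using assms by (simp add: ennreal_mult ennreal_plus distrib_right mult.assoc)
  finally show ?thesis .
qed

end

theorem theorem1:
  fixes P :: "('w, 'a, 's) probing"
    and C \<rho> \<gamma>\<^sub>1 \<gamma>\<^sub>2 :: real
    and A\<^sub>1 :: "real \<Rightarrow> nat set"
    and A\<^sub>2 :: "nat set \<Rightarrow> (nat \<Rightarrow> 'a) \<Rightarrow> 's"
  assumes "probing_instance P"
    and "0 \<le> C" and "\<forall>i\<in>vars P. cost P i \<le> C"
    and "0 \<le> \<rho>" and "0 \<le> \<gamma>\<^sub>1" and "0 \<le> \<gamma>\<^sub>2"
    and "P1 P" and "P2 P \<rho>"
    and "outlier_algorithm P \<gamma>\<^sub>1 A\<^sub>1"
    and "solution_algorithm P \<gamma>\<^sub>2 A\<^sub>2"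
  shows "nonadaptive_value P (A\<^sub>1 C) A\<^sub>2 \<le> ennreal (\<gamma>\<^sub>2 * \<rho> * (\<gamma>\<^sub>1 + 2)) * OPT_h P C \<and>
    (\<forall>\<beta>>0. nonadaptive_value P (A\<^sub>1 ((1 + \<beta>) * C)) A\<^sub>2
      \<le> ennreal (\<gamma>\<^sub>2 * \<rho> * (\<gamma>\<^sub>1 + 2) * (1 + 1 / \<beta>)) * OPT_s P C)"
proof (intro conjI allI impI)
  note bound = nonadaptive_value_le_outlier_opt[OF assms(1,7-10,4-6)]
  have "clairvoyant_value P \<le> OPT_h P C"
    unfolding OPT_h_def using clairvoyant_value_le_policy_value[OF assms(1)]
    by (intro INF_greatest) auto
  then show "nonadaptive_value P (A\<^sub>1 C) A\<^sub>2 \<le> ennreal (\<gamma>\<^sub>2 * \<rho> * (\<gamma>\<^sub>1 + 2)) * OPT_h P C"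
    using outlier_opt_le_OPT_h[OF assms(1,7)] assms(2) by (intro bound)
  fix \<beta> :: real assume \<beta>: "0 < \<beta>"
  have "clairvoyant_value P \<le> OPT_s P C"
    unfolding OPT_s_def using clairvoyant_value_le_policy_value[OF assms(1)]
    by (intro INF_greatest) auto
  \<comment> \<open>The clairvoyant bound is deliberately weakened by a factor of at least 1, to
    share its right-hand side with the outlier bound.\<close>
  also have "\<dots> \<le> ennreal (1 + 1 / \<beta>) * OPT_s P C"
    using mult_right_mono[of 1 "ennreal (1 + 1 / \<beta>)" "OPT_s P C"] \<beta> by simp
  finally have "nonadaptive_value P (A\<^sub>1 ((1 + \<beta>) * C)) A\<^sub>2
      \<le> ennreal (\<gamma>\<^sub>2 * \<rho> * (\<gamma>\<^sub>1 + 2)) * (ennreal (1 + 1 / \<beta>) * OPT_s P C)"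
    using outlier_opt_le_OPT_s[OF assms(1,7,2,3) \<beta>] assms(2) \<beta> by (intro bound) auto
  then show "nonadaptive_value P (A\<^sub>1 ((1 + \<beta>) * C)) A\<^sub>2
      \<le> ennreal (\<gamma>\<^sub>2 * \<rho> * (\<gamma>\<^sub>1 + 2) * (1 + 1 / \<beta>)) * OPT_s P C"
    using assms(4-6) \<beta> by (simp add: ennreal_mult mult.assoc)
qed

end
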